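(* Let $D$ be an infinite, connected digraph which is primitive, distance-transitive, of finite out-valency, and has no directed cycles. If the out-valency of $D$ is $p^2$ for a prime $p$, then the descendant subdigraph of $D$ is a rooted tree; that is, for a vertex $\alpha$ of $D$, the underlying undirected graph of the subdigraph induced on $\mathrm{desc}(\alpha)$ is a tree.
   Context: A digraph $D$ has a vertex set and an edge set $E(D)\subseteq D\times D$ with no loops; subdigraphs are full induced subdigraphs. For an integer $s\ge 0$, an $s$-arc from $u$ to $v$ is a sequence $u_0u_1\dots u_s$ of vertices with $u_0=u$, $u_s=v$, $(u_i,u_{i+1})\in E(D)$ for $0\le i<s$, and $u_{i-1}\ne u_{i+1}$ for $0<i<s$. The descendant set $\mathrm{desc}(u)$ is the set of all vertices reachable from $u$ by an $s$-arc for some $s\ge0$; the descendant subdigraph of $\alpha$ is the subdigraph induced on $\mathrm{desc}(\alpha)$. $D$ is distance-transitive if for every $s\ge 0$, $\mathrm{Aut}(D)$ is transitive on the set of ordered pairs $(u,v)$ such that there is an $s$-arc from $u$ to $v$ but no $t$-arc from $u$ to $v$ for any $t<s$. $D$ is primitive if $\mathrm{Aut}(D)$ acts primitively on the vertex set. The out-valency of a vertex $\alpha$ is $|\{u:(\alpha,u)\in E(D)\}|$. A directed cycle is a sequence of vertices $u_0,u_1,\dots,u_n=u_0$ ($n\ge 1$) with $(u_i,u_{i+1})\in E(D)$ for all $i<n$. *)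

theory Defs
  imports "Graph_Theory.Graph_Theory" "HOL-Combinatorics.Permutations"
    "HOL-Computational_Algebra.Primes"
begin

definition s_arc :: "'a pair_pre_digraph \<Rightarrow> nat \<Rightarrow> 'a \<Rightarrow> 'a list \<Rightarrow> 'a \<Rightarrow> bool" where
  "s_arc D s u us v \<longleftrightarrow>
     length us = Suc s \<and> set us \<subseteq> pverts D \<and> us ! 0 = u \<and> us ! s = v \<and>
     (\<forall>i<s. (us ! i, us ! (i + 1)) \<in> parcs D) \<and>
     (\<forall>i. 0 < i \<and> i < s \<longrightarrow> us ! (i - 1) \<noteq> us ! (i + 1))"

definition desc :: "'a pair_pre_digraph \<Rightarrow> 'a \<Rightarrow> 'a set" where
  "desc D u = {v. \<exists>s us. s_arc D s u us v}"

text \<open>Automorphisms are extended by the identity outside the vertex set.\<close>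

definition Aut :: "'a pair_pre_digraph \<Rightarrow> ('a \<Rightarrow> 'a) set" where
  "Aut D = {g. g permutes pverts D \<and>
     (\<forall>u\<in>pverts D. \<forall>v\<in>pverts D. (g u, g v) \<in> parcs D \<longleftrightarrow> (u, v) \<in> parcs D)}"

definition acts_transitively :: "('x \<Rightarrow> 'x) set \<Rightarrow> 'x set \<Rightarrow> bool" where
  "acts_transitively G X \<longleftrightarrow> (\<forall>x\<in>X. \<forall>y\<in>X. \<exists>g\<in>G. g x = y)"

definition acts_primitively :: "('x \<Rightarrow> 'x) set \<Rightarrow> 'x set \<Rightarrow> bool" where
  "acts_primitively G X \<longleftrightarrow> acts_transitively G X \<and>
     (\<forall>R. equiv X R \<and> (\<forall>g\<in>G. \<forall>(x, y)\<in>R. (g x, g y) \<in> R) \<longrightarrow> R = Id_on X \<or> R = X \<times> X)"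

definition primitive_digraph :: "'a pair_pre_digraph \<Rightarrow> bool" where
  "primitive_digraph D \<longleftrightarrow> acts_primitively (Aut D) (pverts D)"

definition pairs_at_distance :: "'a pair_pre_digraph \<Rightarrow> nat \<Rightarrow> ('a \<times> 'a) set" where
  "pairs_at_distance D s =
     {(u, v). (\<exists>us. s_arc D s u us v) \<and> (\<forall>t<s. \<not> (\<exists>us. s_arc D t u us v))}"

definition distance_transitive :: "'a pair_pre_digraph \<Rightarrow> bool" where
  "distance_transitive D \<longleftrightarrow>
     (\<forall>s. acts_transitively ((\<lambda>g. map_prod g g) ` Aut D) (pairs_at_distance D s))"

text \<open>
  The library's \<^const>\<open>tree\<close> only excludes directed cycles, so it does not say that the underlying
  undirected graph is a tree.  In the symmetric digraph representing that graph, every edge yields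
  a cycle of length 2, while the undirected cycles are exactly the cycles of length at least 3
  (for loop-free digraphs).
\<close>

definition underlying_tree :: "('a, 'b) pre_digraph \<Rightarrow> bool" where
  "underlying_tree G \<longleftrightarrow> connected G \<and>
     \<not> (\<exists>p. pre_digraph.cycle (mk_symmetric G) p \<and> length p \<ge> 3)"

end

theory Submission
  imports Defs
begin

text \<open>
  Since spheres are finite, acyclicity and distance-transitivity make the descendant set of \<open>u\<close>
  layered: all walks from \<open>u\<close> to \<open>x\<close> have the same length.  For a descendant \<open>x\<close> of \<open>u\<close>, let the
  block \<open>B\<^sub>u(x)\<close> consist of the out-neighbours of \<open>u\<close> that have \<open>x\<close> as a descendant.  Its size depends
  only on the level of \<open>x\<close>, blocks grow along arcs, and counting shows that their sizes are powers
  of \<open>p\<close>.  So below some level the size is a constant \<open>c\<close>, and then blocks are inherited by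
  descendants.  If \<open>c = 1\<close>, then every descendant has a unique parent.

  Suppose \<open>c \<ge> p\<close>, and call out-neighbours of \<open>u\<close> near if they lie in a common deep block.  The
  classes of the generated equivalence relation have equal size, which divides \<open>p\<^sup>2\<close> and is at
  least \<open>c\<close>.  It is not \<open>c\<close>, since otherwise a class is a block and its members have the same \<open>n\<close>-th
  levels for large \<open>n\<close>, which primitivity forbids for distinct vertices.  Hence there is only one
  class, for every vertex.  Applied at a descendant \<open>x\<close> of \<open>u\<close>, this shows: if \<open>B\<^sub>u\<close> is
  constant far below each child of \<open>x\<close>, then it is constant far below \<open>x\<close>.  Working upwards to
  \<open>x = u\<close>, there is only one deep block, so \<open>c = p\<^sup>2\<close>, contradicting that \<open>c\<close> is smaller than the size of a class.
\<close>

text \<open>Distances are measured by relation powers, that is, by walks instead of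
  \<open>s_arc\<close>s. In an acyclic digraph no walk backtracks, so both notions agree.\<close>

locale square_valency_digraph =
  fixes V :: "'a set" and E :: "('a \<times> 'a) set" and G :: "('a \<Rightarrow> 'a) set" and p :: nat
  assumes arcs_subset: "E \<subseteq> V \<times> V"
    and acyclic_arcs: "acyclic E"
    and aut_bij: "g \<in> G \<Longrightarrow> bij_betw g V V"
    and aut_arc: "g \<in> G \<Longrightarrow> u \<in> V \<Longrightarrow> v \<in> V \<Longrightarrow> (g u, g v) \<in> E \<longleftrightarrow> (u, v) \<in> E"
    and vertex_transitive: "u \<in> V \<Longrightarrow> v \<in> V \<Longrightarrow> \<exists>g\<in>G. g u = v"
    and distance_transitive:
      "u \<in> V \<Longrightarrow> u' \<in> V \<Longrightarrow> (u, v) \<in> E ^^ n \<Longrightarrow> (u', v') \<in> E ^^ n \<Longrightarrow>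
       \<forall>t<n. (u, v) \<notin> E ^^ t \<Longrightarrow> \<forall>t<n. (u', v') \<notin> E ^^ t \<Longrightarrow> \<exists>g\<in>G. g u = u' \<and> g v = v'"
    and primitive:
      "equiv V R \<Longrightarrow> (\<And>g x y. g \<in> G \<Longrightarrow> (x, y) \<in> R \<Longrightarrow> (g x, g y) \<in> R) \<Longrightarrow>
       R = Id_on V \<or> R = V \<times> V"
    and out_valency: "u \<in> V \<Longrightarrow> card (E `` {u}) = p ^ 2"
    and prime_p: "prime p"
begin

definition level :: "nat \<Rightarrow> 'a \<Rightarrow> 'a set" where
  "level n u = (E ^^ n) `` {u}"

definition block :: "'a \<Rightarrow> 'a \<Rightarrow> 'a set" where
  "block u x = {v \<in> E `` {u}. (v, x) \<in> E\<^sup>*}"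

section \<open>Finiteness of levels and action of automorphisms on walks\<close>

lemma mem_level [simp]: "x \<in> level n u \<longleftrightarrow> (u, x) \<in> E ^^ n"
  by (simp add: level_def)

lemma relpow_in_V: "(u, x) \<in> E ^^ n \<Longrightarrow> u \<in> V \<Longrightarrow> x \<in> V"
  by (cases n) (use arcs_subset in auto)

lemma out_arc_in_V: "(u, v) \<in> E \<Longrightarrow> u \<in> V \<and> v \<in> V"
  using arcs_subset by auto

lemma p_square_gt_1: "1 < p ^ 2"
  using prime_gt_1_nat[OF prime_p] by (rule one_less_power) simp

text \<open>An infinite set has \<open>card\<close> 0, so a valency above 1 forces
  finiteness.\<close>

lemma finite_out: "u \<in> V \<Longrightarrow> finite (E `` {u})"
  using out_valency[of u] p_square_gt_1 by (metis card.infinite not_less_zero)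

lemma finite_level:
  assumes "u \<in> V"
  shows "finite (level n u)"
proof (induction n)
  case 0
  show ?case by (simp add: level_def)
next
  case (Suc n)
  have "level (Suc n) u = (\<Union>x\<in>level n u. E `` {x})"
    by (auto simp: level_def)
  with Suc show ?case
    using relpow_in_V[OF _ assms] finite_out by auto
qed

lemma out_nonempty: "u \<in> V \<Longrightarrow> \<exists>v. (u, v) \<in> E"
  using out_valency[of u] p_square_gt_1 by (cases "E `` {u} = {}") auto

lemma level_nonempty: "u \<in> V \<Longrightarrow> \<exists>x. (u, x) \<in> E ^^ n"
proof (induction n)
  case (Suc n)
  then obtain x where x: "(u, x) \<in> E ^^ n" by auto
  then obtain y where "(x, y) \<in> E" using out_nonempty relpow_in_V Suc.prems by blast
  with x show ?case by auto
qed auto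

lemma aut_in_V: "g \<in> G \<Longrightarrow> u \<in> V \<Longrightarrow> g u \<in> V"
  using aut_bij bij_betwE by blast

lemma aut_eq_iff: "g \<in> G \<Longrightarrow> u \<in> V \<Longrightarrow> v \<in> V \<Longrightarrow> g u = g v \<longleftrightarrow> u = v"
  using aut_bij by (metis bij_betw_imp_inj_on inj_on_eq_iff)

lemma aut_surj: "g \<in> G \<Longrightarrow> v \<in> V \<Longrightarrow> \<exists>u\<in>V. v = g u"
  using aut_bij[of g] by (auto simp: bij_betw_def)

lemma aut_relpow:
  assumes "g \<in> G" "u \<in> V" "v \<in> V"
  shows "(g u, g v) \<in> E ^^ n \<longleftrightarrow> (u, v) \<in> E ^^ n"
  using assms(3)
proof (induction n arbitrary: v)
  case 0
  then show ?case using aut_eq_iff assms by simp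
next
  case (Suc n)
  show ?case
  proof
    assume "(g u, g v) \<in> E ^^ Suc n"
    then obtain w' where w': "(g u, w') \<in> E ^^ n" "(w', g v) \<in> E" by auto
    then obtain w where "w \<in> V" "w' = g w"
      using aut_surj[OF assms(1)] out_arc_in_V by blast
    with w' Suc show "(u, v) \<in> E ^^ Suc n" using aut_arc[OF assms(1)] by auto
  next
    assume "(u, v) \<in> E ^^ Suc n"
    then obtain w where w: "(u, w) \<in> E ^^ n" "(w, v) \<in> E" by auto
    then have "w \<in> V" using out_arc_in_V by blast
    with w Suc show "(g u, g v) \<in> E ^^ Suc n" using aut_arc[OF assms(1)] by auto
  qed
qed

lemma aut_rtrancl:
  assumes "g \<in> G" "u \<in> V" "v \<in> V"
  shows "(g u, g v) \<in> E\<^sup>* \<longleftrightarrow> (u, v) \<in> E\<^sup>*"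
  using aut_relpow[OF assms] by (auto simp: rtrancl_is_UN_relpow)

section \<open>Layering: all walks between two given vertices have the same length\<close>

lemma sphere_antichain:
  assumes u: "u \<in> V"
    and v: "(u, v) \<in> E ^^ n" "\<forall>t<n. (u, v) \<notin> E ^^ t"
    and w: "(u, w) \<in> E ^^ n" "\<forall>t<n. (u, w) \<notin> E ^^ t"
  shows "(v, w) \<notin> E\<^sup>+"
proof
  assume vw: "(v, w) \<in> E\<^sup>+"
  \<comment> \<open>\<open>S\<close> is the sphere of radius \<open>n\<close> around
    \<open>u\<close>. It is finite, so the acyclic relation \<open>E\<^sup>+\<close> restricted to
    it has a sink \<open>z\<close>.\<close>
  define S where "S = {x. (u, x) \<in> E ^^ n \<and> (\<forall>t<n. (u, x) \<notin> E ^^ t)}"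
  have "finite S"
    by (rule finite_subset[OF _ finite_level[OF u, of n]]) (auto simp: S_def)
  then have "finite (E\<^sup>+ \<inter> S \<times> S)" by blast
  moreover have "acyclic (E\<^sup>+ \<inter> S \<times> S)"
    by (rule acyclic_subset[of "E\<^sup>+"]) (use acyclic_arcs in \<open>auto simp: acyclic_def\<close>)
  ultimately have "wf ((E\<^sup>+ \<inter> S \<times> S)\<inverse>)" by (rule finite_acyclic_wf_converse)
  moreover have "v \<in> S" using v by (simp add: S_def)
  ultimately obtain z where z: "z \<in> S" "\<And>y. (z, y) \<in> E\<^sup>+ \<inter> S \<times> S \<Longrightarrow> y \<notin> S"
    by (metis converse_iff wfE_min)
  \<comment> \<open>Moving \<open>v\<close> to the sink \<open>z\<close> while fixing
    \<open>u\<close> carries \<open>w\<close> to a member of the sphere that is a proper descendant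
    of \<open>z\<close>, which a sink does not have.\<close>
  obtain g where g: "g \<in> G" "g u = u" "g v = z"
    using distance_transitive[OF u u v(1), of z] z v by (auto simp: S_def)
  have V: "v \<in> V" "w \<in> V" using relpow_in_V v w u by auto
  have zgw: "(z, g w) \<in> E\<^sup>+"
    using vw aut_relpow[OF g(1) V] g(3) by (auto simp: trancl_power)
  have gw_iff: "(u, g w) \<in> E ^^ k \<longleftrightarrow> (u, w) \<in> E ^^ k" for k
    using aut_relpow[OF g(1) u V(2), of k] unfolding g(2) .
  have "g w \<in> S" unfolding S_def mem_Collect_eq gw_iff using w by (rule conjI)
  then show False using z zgw by blast
qed

lemma relpow_shortest:
  assumes "u \<in> V" "(u, v) \<in> E ^^ t" "s < t"
  shows "(u, v) \<notin> E ^^ s"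
  using assms(2,3)
proof (induction t arbitrary: v s rule: less_induct)
  case (less t)
  show ?case
  proof
    assume "(u, v) \<in> E ^^ s"
    \<comment> \<open>\<open>r\<close> is the distance from \<open>u\<close> to \<open>v\<close>.
      Cut the walk of length \<open>t\<close> after \<open>r\<close> steps, at \<open>w\<close>: by
      induction \<open>w\<close> is also at distance exactly \<open>r\<close>, and \<open>v\<close>
      is a proper descendant of \<open>w\<close> in the same sphere.\<close>
    define r where "r = (LEAST q. (u, v) \<in> E ^^ q)"
    have r: "(u, v) \<in> E ^^ r" "r \<le> s" "\<forall>q<r. (u, v) \<notin> E ^^ q"
      unfolding r_def using \<open>(u, v) \<in> E ^^ s\<close>
      by (rule LeastI, rule Least_le) (use not_less_Least in blast)
    have "r < t" using r less.prems by simp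
    then have "(u, v) \<in> E ^^ (r + (t - r))" using less.prems by simp
    then obtain w where w: "(u, w) \<in> E ^^ r" "(w, v) \<in> E ^^ (t - r)"
      unfolding relpow_add by auto
    have "(w, v) \<in> E\<^sup>+" using w(2) \<open>r < t\<close> unfolding trancl_power by (intro exI[of _ "t - r"]) simp
    moreover have "\<forall>q<r. (u, w) \<notin> E ^^ q" using less.IH[OF \<open>r < t\<close> w(1)] by blast
    ultimately show False using sphere_antichain[OF assms(1) w(1) _ r(1)] r by blast
  qed
qed

lemma relpow_unique: "u \<in> V \<Longrightarrow> (u, v) \<in> E ^^ s \<Longrightarrow> (u, v) \<in> E ^^ t \<Longrightarrow> s = t"
  using relpow_shortest by (metis nat_neq_iff)

text \<open>Every walk is now a shortest one, so distance-transitivity applies to the endpoints of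
  any two walks of equal length.\<close>

lemma aut_exists:
  assumes "u \<in> V" "u' \<in> V" "(u, v) \<in> E ^^ n" "(u', v') \<in> E ^^ n"
  shows "\<exists>g\<in>G. g u = u' \<and> g v = v'"
  using distance_transitive assms relpow_shortest by blast

section \<open>Invariance of levels and blocks, and of their sizes\<close>

lemma aut_level:
  assumes "g \<in> G" "u \<in> V"
  shows "level n (g u) = g ` level n u"
proof (intro equalityI subsetI)
  fix x assume x: "x \<in> level n (g u)"
  then have "x \<in> V" using relpow_in_V aut_in_V assms by auto
  then obtain y where "y \<in> V" "x = g y" using aut_surj assms by blast
  then show "x \<in> g ` level n u" using x aut_relpow[OF assms] by auto
next
  fix x assume "x \<in> g ` level n u"
  then show "x \<in> level n (g u)" using aut_relpow[OF assms] relpow_in_V assms by auto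
qed

lemma aut_block:
  assumes "g \<in> G" "u \<in> V" "x \<in> V"
  shows "block (g u) (g x) = g ` block u x"
proof (intro equalityI subsetI)
  fix z assume z: "z \<in> block (g u) (g x)"
  then have "z \<in> V" using out_arc_in_V by (auto simp: block_def)
  then obtain y where y: "y \<in> V" "z = g y" using aut_surj assms by blast
  with z have "y \<in> block u x" using aut_arc[OF assms(1,2)] aut_rtrancl[OF assms(1) _ assms(3)]
    by (auto simp: block_def)
  then show "z \<in> g ` block u x" using y by auto
next
  fix z assume "z \<in> g ` block u x"
  then show "z \<in> block (g u) (g x)"
    using aut_arc[OF assms(1,2)] aut_rtrancl[OF assms(1) _ assms(3)] out_arc_in_V
    by (auto simp: block_def)
qed

lemma card_aut_image: "g \<in> G \<Longrightarrow> A \<subseteq> V \<Longrightarrow> card (g ` A) = card A"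
  by (meson aut_bij bij_betw_imp_inj_on card_image inj_on_subset)

lemma level_subset: "u \<in> V \<Longrightarrow> level n u \<subseteq> V"
  using relpow_in_V by auto

lemma block_subset: "block u x \<subseteq> E `` {u}"
  by (auto simp: block_def)

lemma block_subset_V: "block u x \<subseteq> V"
  using out_arc_in_V by (auto simp: block_def)

lemma finite_block: "u \<in> V \<Longrightarrow> finite (block u x)"
  using block_subset finite_out finite_subset by metis

lemma card_block_eq:
  assumes "u \<in> V" "u' \<in> V" "(u, x) \<in> E ^^ n" "(u', x') \<in> E ^^ n"
  shows "card (block u x) = card (block u' x')"
proof -
  obtain g where "g \<in> G" "g u = u'" "g x = x'" using aut_exists[OF assms] by blast
  then show ?thesis
    using aut_block[of g u x] card_aut_image[of g "block u x"] block_subset_V assms relpow_in_V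
    by metis
qed

lemma card_level_eq:
  assumes "u \<in> V" "v \<in> V"
  shows "card (level n u) = card (level n v)"
  using vertex_transitive[OF assms] aut_level card_aut_image level_subset assms by metis

section \<open>Structure of blocks and counting of their sizes\<close>

lemma block_iff:
  assumes "u \<in> V" "(u, x) \<in> E ^^ Suc n"
  shows "v \<in> block u x \<longleftrightarrow> (u, v) \<in> E \<and> (v, x) \<in> E ^^ n"
proof
  assume "v \<in> block u x"
  then obtain k where "(u, v) \<in> E" "(v, x) \<in> E ^^ k"
    by (auto simp: block_def rtrancl_power)
  moreover from this have "(u, x) \<in> E ^^ Suc k" by (rule relpow_Suc_I2)
  ultimately show "(u, v) \<in> E \<and> (v, x) \<in> E ^^ n"
    using relpow_unique[OF assms(1) _ assms(2), of "Suc k"] by simp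
qed (auto simp: block_def rtrancl_power)

lemma block_nonempty: "(u, x) \<in> E ^^ Suc n \<Longrightarrow> block u x \<noteq> {}"
  by (drule relpow_Suc_D2) (auto simp: block_def rtrancl_power)

lemma block_mono: "(x, y) \<in> E\<^sup>* \<Longrightarrow> block u x \<subseteq> block u y"
  by (auto simp: block_def intro: rtrancl_trans)

text \<open>Double counting of the pairs of an out-neighbour \<open>v\<close> of \<open>u\<close>
  and a vertex \<open>x\<close> at level \<open>Suc n\<close> with a walk of length \<open>n\<close>
  from \<open>v\<close> to \<open>x\<close>. For fixed \<open>v\<close> these \<open>x\<close> form
  \<open>level n v\<close>; for fixed \<open>x\<close> these \<open>v\<close> form the
  block.\<close>

lemma level_block_count:
  assumes u: "u \<in> V" and c: "\<And>x. (u, x) \<in> E ^^ Suc n \<Longrightarrow> card (block u x) = c"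
  shows "p ^ 2 * card (level n u) = c * card (level (Suc n) u)"
proof -
  let ?T = "level (Suc n) u"
  have "(\<Sum>v\<in>E `` {u}. card {x \<in> ?T. (v, x) \<in> E ^^ n}) = c * card ?T"
  proof (rule sum_multicount)
    show "\<forall>x\<in>?T. card {v \<in> E `` {u}. (v, x) \<in> E ^^ n} = c"
    proof
      fix x assume "x \<in> ?T"
      then have x: "(u, x) \<in> E ^^ Suc n" by simp
      then have "{v \<in> E `` {u}. (v, x) \<in> E ^^ n} = block u x"
        using block_iff[OF u x] by auto
      then show "card {v \<in> E `` {u}. (v, x) \<in> E ^^ n} = c" using c[OF x] by simp
    qed
  qed (use finite_out finite_level u in auto)
  moreover have "card {x \<in> ?T. (v, x) \<in> E ^^ n} = card (level n u)" if "v \<in> E `` {u}" for v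
  proof -
    have "{x \<in> ?T. (v, x) \<in> E ^^ n} = level n v"
      using that relpow_Suc_I2[of u v E] by auto
    then show ?thesis using card_level_eq[OF u, of v n] that out_arc_in_V by (metis Image_singleton_iff)
  qed
  ultimately show ?thesis using out_valency[OF u] by simp
qed

text \<open>By the count, the size of each level divides \<open>p ^ 2\<close> times that of the
  previous one.\<close>

lemma card_level_dvd: "u \<in> V \<Longrightarrow> card (level n u) dvd p ^ (2 * n)"
proof (induction n)
  case 0
  then show ?case by (simp add: level_def)
next
  case (Suc n)
  obtain x where x: "(u, x) \<in> E ^^ Suc n" using level_nonempty[OF Suc.prems] by blast
  have "p ^ 2 * card (level n u) = card (block u x) * card (level (Suc n) u)"
    using level_block_count[OF Suc.prems] card_block_eq[OF Suc.prems Suc.prems _ x] by blast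
  moreover have "p ^ 2 * card (level n u) dvd p ^ 2 * p ^ (2 * n)"
    using Suc by (simp add: mult_dvd_mono)
  ultimately show ?case by (metis dvd_mult_right power_add mult_Suc_right)
qed

text \<open>The block size is the other factor in the same product. As a divisor of a power of the
  prime \<open>p\<close> it is itself a power of \<open>p\<close>.\<close>

lemma card_block_dvd:
  assumes u: "u \<in> V" and x: "(u, x) \<in> E ^^ Suc n"
  shows "card (block u x) dvd p ^ (2 * Suc n)"
proof -
  have "p ^ 2 * card (level n u) = card (block u x) * card (level (Suc n) u)"
    using level_block_count[OF u] card_block_eq[OF u u _ x] by blast
  moreover have "p ^ 2 * card (level n u) dvd p ^ 2 * p ^ (2 * n)"
    using card_level_dvd[OF u] by (simp add: mult_dvd_mono)
  ultimately show ?thesis by (metis dvd_mult_left power_add mult_Suc_right)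
qed

section \<open>Primitivity: distinct vertices have distinct levels\<close>

lemma level_add: "level (n + k) u = (E ^^ k) `` level n u"
  by (auto simp: level_def relpow_add)

text \<open>Once two levels agree, all later ones do, so sharing some level is an invariant
  equivalence relation. It is not universal: for an arc from \<open>u\<close> to \<open>w\<close>
  with equal \<open>k\<close>-th levels, a vertex of that level would be reached from
  \<open>u\<close> in \<open>k\<close> and in \<open>Suc k\<close> steps. By primitivity it is
  equality.\<close>

lemma level_eqD:
  assumes "u \<in> V" "v \<in> V" "level n u = level n v"
  shows "u = v"
proof -
  define R where "R = {(x, y). x \<in> V \<and> y \<in> V \<and> (\<exists>k. level k x = level k y)}"
  have "equiv V R"
  proof (rule equivI)
    show "R \<subseteq> V \<times> V" by (auto simp: R_def)
    show "refl_on V R" by (auto simp: R_def refl_on_def)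
    show "sym R" by (rule symI) (force simp: R_def)
    show "trans R"
    proof (rule transI)
      fix x y z assume "(x, y) \<in> R" "(y, z) \<in> R"
      then obtain i j where *: "x \<in> V" "z \<in> V" "level i x = level i y" "level j y = level j z"
        by (auto simp: R_def)
      then have "level (i + j) x = level (j + i) z"
        by (metis add.commute level_add)
      with * show "(x, z) \<in> R" by (auto simp: R_def add.commute)
    qed
  qed
  moreover have "(g x, g y) \<in> R" if "g \<in> G" "(x, y) \<in> R" for g x y
    using that aut_in_V aut_level[OF that(1)] unfolding R_def by (auto; metis)
  ultimately have "R = Id_on V \<or> R = V \<times> V" by (rule primitive)
  moreover have "R \<noteq> V \<times> V"
  proof
    assume "R = V \<times> V"
    obtain w where w: "(u, w) \<in> E" using out_nonempty[OF assms(1)] by blast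
    with \<open>R = V \<times> V\<close> have "(u, w) \<in> R" using out_arc_in_V by auto
    then obtain k where k: "level k u = level k w" by (auto simp: R_def)
    obtain x where x: "(w, x) \<in> E ^^ k" using level_nonempty out_arc_in_V w by blast
    then have "(u, x) \<in> E ^^ Suc k" by (rule relpow_Suc_I2[OF w])
    moreover have "(u, x) \<in> E ^^ k" using x k mem_level by metis
    ultimately have "Suc k = k" by (rule relpow_unique[OF assms(1)])
    then show False by simp
  qed
  moreover have "(u, v) \<in> R" using assms by (auto simp: R_def)
  ultimately show ?thesis by auto
qed

section \<open>Classes of out-neighbours generated by deep blocks\<close>

definition near :: "nat \<Rightarrow> 'a \<Rightarrow> ('a \<times> 'a) set" where
  "near N u = {(v, w). \<exists>n\<ge>N. \<exists>x. (u, x) \<in> E ^^ Suc n \<and> v \<in> block u x \<and> w \<in> block u x}"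

lemma near_subset: "near N u \<subseteq> E `` {u} \<times> E `` {u}"
  by (auto simp: near_def block_def)

lemma near_rtrancl_out: "(v, w) \<in> (near N u)\<^sup>* \<Longrightarrow> (u, v) \<in> E \<Longrightarrow> (u, w) \<in> E"
  by (induction rule: rtrancl_induct) (use near_subset in auto)

lemma near_class_subset: "(u, v) \<in> E \<Longrightarrow> (near N u)\<^sup>* `` {v} \<subseteq> E `` {u}"
  using near_rtrancl_out by auto

lemma aut_near:
  assumes "g \<in> G" "u \<in> V" "(v, w) \<in> near N u"
  shows "(g v, g w) \<in> near N (g u)"
proof -
  obtain n x where n: "n \<ge> N" "(u, x) \<in> E ^^ Suc n" "v \<in> block u x" "w \<in> block u x"
    using assms(3) by (auto simp: near_def)
  have x: "x \<in> V" using relpow_in_V n assms by blast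
  then have "(g u, g x) \<in> E ^^ Suc n" using aut_relpow assms n by blast
  moreover have "g v \<in> block (g u) (g x)" "g w \<in> block (g u) (g x)"
    using aut_block[OF assms(1,2) x] n by auto
  ultimately show ?thesis using n(1) unfolding near_def by blast
qed

lemma aut_near_rtrancl:
  assumes "g \<in> G" "u \<in> V"
  shows "(v, w) \<in> (near N u)\<^sup>* \<Longrightarrow> (g v, g w) \<in> (near N (g u))\<^sup>*"
  by (induction rule: rtrancl_induct) (use aut_near[OF assms] in \<open>auto intro: rtrancl_into_rtrancl\<close>)

text \<open>Automorphisms fixing \<open>u\<close> are transitive on its out-neighbours, since these
  are the endpoints of walks of length 1. One taking \<open>v\<close> to \<open>w\<close> maps the
  class of \<open>v\<close> into that of \<open>w\<close>.\<close>

lemma card_near_class_le: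
  assumes u: "u \<in> V" and v: "(u, v) \<in> E" and w: "(u, w) \<in> E"
  shows "card ((near N u)\<^sup>* `` {v}) \<le> card ((near N u)\<^sup>* `` {w})"
proof -
  obtain g where g: "g \<in> G" "g u = u" "g v = w" using aut_exists[OF u u, of v 1 w] v w by auto
  have "g ` ((near N u)\<^sup>* `` {v}) \<subseteq> (near N u)\<^sup>* `` {w}"
    using aut_near_rtrancl[OF g(1) u] g by auto
  moreover have "card (g ` ((near N u)\<^sup>* `` {v})) = card ((near N u)\<^sup>* `` {v})"
    by (rule card_aut_image[OF g(1)]) (use near_class_subset[OF v] arcs_subset in blast)
  moreover have "finite ((near N u)\<^sup>* `` {w})"
    using near_class_subset[OF w] finite_out[OF u] finite_subset by blast
  ultimately show ?thesis by (metis card_mono)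
qed

text \<open>The classes partition the \<open>p ^ 2\<close> out-neighbours, and
  \<open>card_near_class_le\<close> used in both directions makes them equally large.\<close>

lemma card_near_class_dvd:
  assumes u: "u \<in> V" and v: "(u, v) \<in> E"
  shows "card ((near N u)\<^sup>* `` {v}) dvd p ^ 2"
proof -
  \<comment> \<open>The closure is reflexive on the whole type, so it is restricted to the
    out-neighbours to obtain an equivalence there; their classes do not change.\<close>
  let ?X = "E `` {u}" and ?R = "(near N u)\<^sup>* \<inter> E `` {u} \<times> E `` {u}"
  have "sym (near N u)" by (rule symI) (auto simp: near_def)
  then have "sym ((near N u)\<^sup>*)" by (rule sym_rtrancl)
  then have "equiv ?X ?R"
    by (intro equivI) (auto simp: refl_on_def sym_def trans_def intro: rtrancl_trans)
  moreover have "\<forall>C\<in>?X // ?R. card ((near N u)\<^sup>* `` {v}) dvd card C"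
  proof
    fix C assume "C \<in> ?X // ?R"
    then obtain w where w: "(u, w) \<in> E" "C = ?R `` {w}" by (auto elim: quotientE)
    then have "C = (near N u)\<^sup>* `` {w}" using near_class_subset[OF w(1)] by auto
    then show "card ((near N u)\<^sup>* `` {v}) dvd card C"
      using card_near_class_le[OF u v w(1), of N] card_near_class_le[OF u w(1) v, of N] by simp
  qed
  ultimately have "card ((near N u)\<^sup>* `` {v}) dvd card ?X"
    using equiv_imp_dvd_card[OF finite_out[OF u]] by blast
  then show ?thesis using out_valency[OF u] by simp
qed

text \<open>A block at level \<open>Suc N\<close> that meets the class lies inside it and has size
  \<open>c\<close>. If the class had at most \<open>c\<close> elements, every such block would be
  the whole class.\<close>

lemma near_class_card_gt:
  assumes c: "\<And>n u x. n \<ge> N \<Longrightarrow> u \<in> V \<Longrightarrow> (u, x) \<in> E ^^ Suc n \<Longrightarrow> card (block u x) = c"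
    and "c \<ge> 2" and u: "u \<in> V" and v: "(u, v) \<in> E"
  shows "c < card ((near N u)\<^sup>* `` {v})"
proof (rule ccontr)
  let ?C = "(near N u)\<^sup>* `` {v}"
  have fin: "finite ?C" using near_class_subset[OF v] finite_out[OF u] finite_subset by blast
  have sub: "block u x \<subseteq> ?C" if "w \<in> ?C" "w \<in> block u x" "(u, x) \<in> E ^^ Suc N" for w x
    using that by (auto simp: near_def intro!: rtrancl_into_rtrancl[of v w])
  assume "\<not> c < card ?C"
  then have eq: "block u x = ?C" if "w \<in> ?C" "w \<in> block u x" "(u, x) \<in> E ^^ Suc N" for w x
    using card_seteq[OF fin sub[OF that]] c[OF _ u that(3)] by simp
  \<comment> \<open>A descendant \<open>N\<close> steps below one member has the whole class as its
    block, so it lies \<open>N\<close> steps below every member. By \<open>level_eqD\<close> the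
    class is then a single vertex, too small to contain a block of size \<open>c\<close>.\<close>
  have lev: "level N w \<subseteq> level N w'" if "w \<in> ?C" "w' \<in> ?C" for w w'
  proof
    fix x assume "x \<in> level N w"
    moreover have "(u, w) \<in> E" using near_class_subset[OF v] that by blast
    ultimately have x: "(u, x) \<in> E ^^ Suc N" "w \<in> block u x"
      using relpow_Suc_I2[of u w E] by (auto simp: block_def rtrancl_power)
    then have "w' \<in> block u x" using eq[OF that(1)] that(2) by simp
    then show "x \<in> level N w'" using block_iff[OF u x(1)] by simp
  qed
  have "w = v" if "w \<in> ?C" for w
  proof (rule level_eqD)
    show "w \<in> V" "v \<in> V" using that near_class_subset[OF v] v out_arc_in_V by blast+
    show "level N w = level N v" using lev[OF that, of v] lev[of v w] that by auto
  qed
  then have "?C \<subseteq> {v}" by auto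
  moreover obtain x where x: "(v, x) \<in> E ^^ N" using level_nonempty v out_arc_in_V by blast
  then have ux: "(u, x) \<in> E ^^ Suc N" "v \<in> block u x"
    using relpow_Suc_I2[OF v] v by (auto simp: block_def rtrancl_power)
  ultimately have "block u x \<subseteq> {v}" using eq[of v x] by auto
  then have "card (block u x) \<le> 1" using card_mono[of "{v}"] by fastforce
  then show False using c[OF _ u ux(1)] \<open>c \<ge> 2\<close> by simp
qed

text \<open>The class size is \<open>p ^ j\<close> with \<open>j\<close> at most 2, and
  \<open>c\<close> is a power of \<open>p\<close> with positive exponent that is strictly smaller.
  Hence \<open>j = 2\<close>, and the class exhausts the out-neighbours.\<close>

lemma near_connected:
  assumes c: "\<And>n u x. n \<ge> N \<Longrightarrow> u \<in> V \<Longrightarrow> (u, x) \<in> E ^^ Suc n \<Longrightarrow> card (block u x) = c"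
    and "c \<ge> 2" and u: "u \<in> V" and v: "(u, v) \<in> E"
  shows "(near N u)\<^sup>* `` {v} = E `` {u}"
proof -
  let ?C = "(near N u)\<^sup>* `` {v}"
  obtain x where x: "(u, x) \<in> E ^^ Suc N" using level_nonempty[OF u] by blast
  then have "c dvd p ^ (2 * Suc N)" using card_block_dvd[OF u x] c[OF _ u x] by simp
  then obtain i where i: "c = p ^ i" using divides_primepow_nat[OF prime_p] by blast
  obtain j where j: "j \<le> 2" "card ?C = p ^ j"
    using card_near_class_dvd[OF u v] divides_primepow_nat[OF prime_p] by blast
  have "c < card ?C" by (rule near_class_card_gt[OF c \<open>c \<ge> 2\<close> u v])
  then have "i < j"
    using i j prime_gt_1_nat[OF prime_p] by simp
  moreover have "i \<noteq> 0" using i \<open>c \<ge> 2\<close> by (cases i) auto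
  ultimately have "j = 2" using j(1) by simp
  then have "card ?C = card (E `` {u})" using j(2) out_valency[OF u] by simp
  then show ?thesis
    using card_subset_eq[OF finite_out[OF u] near_class_subset[OF v]] by blast
qed

section \<open>Constancy of deep blocks, propagated upwards\<close>

lemma block_constant_below:
  assumes c: "\<And>n u x. n \<ge> N \<Longrightarrow> u \<in> V \<Longrightarrow> (u, x) \<in> E ^^ Suc n \<Longrightarrow> card (block u x) = c"
    and "c \<ge> 2" and u: "u \<in> V" and x: "(u, x) \<in> E ^^ j" and j: "j + d = Suc N"
  shows "\<exists>B. \<forall>k\<ge>d + N. \<forall>y. (x, y) \<in> E ^^ k \<longrightarrow> block u y = B"
  using x j
\<comment> \<open>\<open>d\<close> is the number of levels from \<open>x\<close> down to level
  \<open>Suc N\<close> of \<open>u\<close>; the induction climbs from that level towards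
  \<open>u\<close>.\<close>
proof (induction d arbitrary: j x)
  case 0
  \<comment> \<open>From level \<open>Suc N\<close> on, blocks grow along walks but keep size
    \<open>c\<close>, so descendants inherit them.\<close>
  have "block u y = block u x" if "(x, y) \<in> E ^^ k" for y k
  proof -
    have "(u, y) \<in> E ^^ Suc (N + k)"
      using 0 that relpow_add[of j k E] by auto
    then have "card (block u y) = card (block u x)" using c[OF _ u] 0
      by (metis add.right_neutral le_add1)
    moreover have "block u x \<subseteq> block u y" using block_mono that by (meson relpow_imp_rtrancl)
    ultimately show ?thesis using card_subset_eq[OF finite_block[OF u]] by metis
  qed
  then show ?case by blast
next
  case (Suc d)
  have xV: "x \<in> V" using relpow_in_V Suc.prems u by blast
  have "\<exists>B. \<forall>k\<ge>d + N. \<forall>y. (v, y) \<in> E ^^ k \<longrightarrow> block u y = B" if "(x, v) \<in> E" for v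
    using Suc.IH[of v "Suc j"] Suc.prems that by auto
  then obtain f where
    f: "\<And>v k y. (x, v) \<in> E \<Longrightarrow> k \<ge> d + N \<Longrightarrow> (v, y) \<in> E ^^ k \<Longrightarrow> block u y = f v"
    by metis
  have near_f: "f v = f w" if vw: "(v, w) \<in> near N x" for v w
  proof -
    obtain n y where n: "n \<ge> N" "(x, y) \<in> E ^^ Suc n" "v \<in> block x y" "w \<in> block x y"
      using vw unfolding near_def by blast
    have "y \<in> V" using relpow_in_V n xV by blast
    \<comment> \<open>The common descendant \<open>y\<close> may be only \<open>N\<close> steps
      below \<open>v\<close> and \<open>w\<close>, whereas \<open>f\<close> describes blocks from
      depth \<open>d + N\<close> on. Going \<open>d\<close> steps further reaches that depth below
      both, so \<open>f v\<close> and \<open>f w\<close> are the block of the same vertex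
      \<open>z\<close>.\<close>
    then obtain z where z: "(y, z) \<in> E ^^ d" using level_nonempty by blast
    have "(v, z) \<in> E ^^ (n + d)" "(w, z) \<in> E ^^ (n + d)"
      using block_iff[OF xV n(2)] n z by (auto simp: relpow_add)
    moreover have "(x, v) \<in> E" "(x, w) \<in> E" using n block_subset by auto
    moreover have "n + d \<ge> d + N" using n by simp
    ultimately show ?thesis using f by metis
  qed
  have rtrancl_f: "(v, w) \<in> (near N x)\<^sup>* \<Longrightarrow> f v = f w" for v w
    by (induction rule: rtrancl_induct) (use near_f in auto)
  obtain v where v: "(x, v) \<in> E" using out_nonempty[OF xV] by blast
  have "(near N x)\<^sup>* `` {v} = E `` {x}" by (rule near_connected[OF c \<open>c \<ge> 2\<close> xV v])
  then have const: "f w = f v" if "(x, w) \<in> E" for w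
    using rtrancl_f[of v w] that by blast
  have "block u y = f v" if k: "k \<ge> Suc d + N" "(x, y) \<in> E ^^ k" for k y
  proof -
    obtain k' where k': "k = Suc k'" "k' \<ge> d + N" using k by (cases k) auto
    then obtain w where "(x, w) \<in> E" "(w, y) \<in> E ^^ k'" using k relpow_Suc_D2 by metis
    then show ?thesis using f k' const by metis
  qed
  then show ?case by blast
qed

text \<open>Otherwise \<open>block_constant_below\<close> at \<open>u\<close> itself leaves a single
  deep block. It contains every out-neighbour, so the valency is at most \<open>c\<close>, although
  a class of out-neighbours has more than \<open>c\<close> elements.\<close>

lemma stable_block_card_lt_2:
  assumes c: "\<And>n u x. n \<ge> N \<Longrightarrow> u \<in> V \<Longrightarrow> (u, x) \<in> E ^^ Suc n \<Longrightarrow> card (block u x) = c"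
    and u: "u \<in> V"
  shows "c < 2"
proof (rule ccontr)
  assume "\<not> c < 2"
  then have "c \<ge> 2" by simp
  have "\<exists>B. \<forall>k\<ge>Suc N + N. \<forall>y. (u, y) \<in> E ^^ k \<longrightarrow> block u y = B"
    by (rule block_constant_below[OF c \<open>c \<ge> 2\<close> u, where j = 0]) auto
  then obtain B where B: "\<forall>k\<ge>Suc N + N. \<forall>y. (u, y) \<in> E ^^ k \<longrightarrow> block u y = B"
    by (rule exE)
  have mem: "v \<in> B \<and> card B = c" if uv: "(u, v) \<in> E" for v
  proof -
    \<comment> \<open>Together with the arc from \<open>u\<close> to \<open>v\<close> this walk has
      length \<open>Suc N + N\<close>, exactly the depth from which \<open>B\<close> is the
      block.\<close>
    obtain y where y: "(v, y) \<in> E ^^ (N + N)" using level_nonempty out_arc_in_V[OF uv] by blast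
    then have uy: "(u, y) \<in> E ^^ Suc (N + N)" by (rule relpow_Suc_I2[OF uv])
    then have "block u y = B" using B[rule_format, of "Suc (N + N)" y] by simp
    moreover have "v \<in> block u y" using uv y by (auto simp: block_def rtrancl_power)
    ultimately show ?thesis using c[OF _ u uy] by simp
  qed
  obtain v where v: "(u, v) \<in> E" using out_nonempty[OF u] by blast
  have "finite B" using mem[OF v] \<open>c \<ge> 2\<close> card.infinite by fastforce
  then have "card (E `` {u}) \<le> c" using mem v card_mono[of B "E `` {u}"] by auto
  moreover have "card ((near N u)\<^sup>* `` {v}) \<le> card (E `` {u})"
    by (rule card_mono[OF finite_out[OF u] near_class_subset[OF v]])
  moreover have "c < card ((near N u)\<^sup>* `` {v})"
    by (rule near_class_card_gt[OF c \<open>c \<ge> 2\<close> u v])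
  ultimately show False by simp
qed

section \<open>Blocks are singletons, hence parents are unique\<close>

lemma card_block:
  assumes u: "u \<in> V" and x: "(u, x) \<in> E ^^ Suc n"
  shows "card (block u x) = 1"
proof -
  have "\<exists>y. (u, y) \<in> E ^^ Suc n" for n by (rule level_nonempty[OF u])
  then obtain h where h: "\<And>n. (u, h n) \<in> E ^^ Suc n"
    by metis
  \<comment> \<open>\<open>b n\<close> is the common block size at level \<open>Suc n\<close>, with
    the sample vertex \<open>h n\<close> as representative; level 0 has no block to measure.\<close>
  define b where "b n = card (block u (h n))" for n
  have b: "card (block v y) = b n" if "v \<in> V" "(v, y) \<in> E ^^ Suc n" for v y n
    unfolding b_def using card_block_eq[OF that(1) u that(2) h] .
  have "mono b"
  proof (rule monoI, erule lift_Suc_mono_le[rotated])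
    fix n
    obtain y where y: "(h n, y) \<in> E" using out_nonempty relpow_in_V[OF h u] by blast
    then have "(u, y) \<in> E ^^ Suc (Suc n)" by (rule relpow_Suc_I[OF h])
    then have "b (Suc n) = card (block u y)" using b[OF u] by metis
    moreover have "block u (h n) \<subseteq> block u y" using block_mono y by blast
    ultimately show "b n \<le> b (Suc n)"
      using card_mono[OF finite_block[OF u]] b_def by metis
  qed
  have bound: "b n \<le> p ^ 2" for n
    unfolding b_def using card_mono[OF finite_out[OF u] block_subset] out_valency[OF u] by metis
  obtain N where N: "\<And>n. b n \<le> b N"
    using ex_has_greatest_nat[of "\<lambda>_. True" _ b "Suc (p ^ 2)"] bound
    by (auto simp: less_Suc_eq_le)
  have "b n = b N" if "n \<ge> N" for n
    using N[of n] \<open>mono b\<close> that by (simp add: antisym monoD)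
  then have "b N < 2" using stable_block_card_lt_2[of N "b N"] b u by metis
  moreover have "b n \<noteq> 0"
    using block_nonempty[OF h] finite_block[OF u] by (simp add: b_def)
  \<comment> \<open>\<open>b N\<close> is the maximum of \<open>b\<close>, so the bound 2 also
    reaches the levels above the stable range.\<close>
  ultimately have "b n = 1" using N[of n] by simp
  then show ?thesis using b[OF u x] by simp
qed

text \<open>The first vertices after \<open>u\<close> on the walks through \<open>x\<close> and
  \<open>x'\<close> both lie in the singleton \<open>block u y\<close>, so they coincide and serve
  as the new starting point.\<close>

lemma unique_parent_level:
  assumes "u \<in> V" "(u, x) \<in> E ^^ n" "(u, x') \<in> E ^^ n" "(x, y) \<in> E" "(x', y) \<in> E"
  shows "x = x'"
  using assms
proof (induction n arbitrary: u)
  case (Suc n)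
  obtain v v' where v: "(u, v) \<in> E" "(v, x) \<in> E ^^ n" "(u, v') \<in> E" "(v', x') \<in> E ^^ n"
    using Suc.prems(2,3) relpow_Suc_D2 by metis
  have "(u, y) \<in> E ^^ Suc (Suc n)" using Suc.prems by auto
  then have "card (block u y) = 1" by (rule card_block[OF Suc.prems(1)])
  moreover have "(v, y) \<in> E\<^sup>*" "(v', y) \<in> E\<^sup>*"
    using v Suc.prems(4,5) by (meson relpow_imp_rtrancl rtrancl.rtrancl_into_rtrancl)+
  then have "v \<in> block u y" "v' \<in> block u y"
    using v by (auto simp: block_def)
  ultimately have "v = v'" by (auto simp: card_1_singleton_iff)
  then show ?case using Suc.IH[of v] v Suc.prems out_arc_in_V by blast
qed auto

lemma unique_parent:
  assumes "u \<in> V" "(u, x) \<in> E ^^ i" "(u, x') \<in> E ^^ j" "(x, y) \<in> E" "(x', y) \<in> E"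
  shows "x = x'"
proof -
  have "(u, y) \<in> E ^^ Suc i" "(u, y) \<in> E ^^ Suc j" using assms by auto
  then have "i = j" using relpow_unique[OF assms(1)] by blast
  then show ?thesis using unique_parent_level assms by blast
qed

end

section \<open>Unique parents exclude undirected cycles\<close>

lemma no_cycle_of_unique_parent:
  fixes A :: "('a \<times> 'a) set" and l :: "'a \<Rightarrow> nat"
  assumes level: "\<And>x y. (x, y) \<in> A \<Longrightarrow> l y = Suc (l x)"
    and parent: "\<And>x x' y. (x, y) \<in> A \<Longrightarrow> (x', y) \<in> A \<Longrightarrow> x = x'"
    and arcs: "\<And>x y. (x, y) \<in> set q \<Longrightarrow> (x, y) \<in> A \<or> (y, x) \<in> A"
    and consecutive: "\<And>i. Suc i < length q \<Longrightarrow> snd (q ! i) = fst (q ! Suc i)"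
    and closed: "snd (q ! (length q - 1)) = fst (q ! 0)"
    and dist: "distinct (map snd q)"
  shows "length q < 3"
proof (rule ccontr)
  let ?k = "length q"
  assume "\<not> ?k < 3"
  have nth_eq: "i = j" if "snd (q ! i) = snd (q ! j)" "i < ?k" "j < ?k" for i j
    using dist that by (auto simp: distinct_conv_nth)
  \<comment> \<open>At a vertex of highest level on the cycle, both neighbours must be parents. They
    would coincide, which a cycle with at least 3 edges does not allow.\<close>
  obtain i where i: "i < ?k" and max: "\<And>j. j < ?k \<Longrightarrow> l (snd (q ! j)) \<le> l (snd (q ! i))"
  proof -
    let ?S = "(\<lambda>i. l (snd (q ! i))) ` {..<?k}"
    have "0 \<in> {..<?k}" using \<open>\<not> ?k < 3\<close> by (metis lessThan_iff gr_zeroI zero_less_numeral)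
    then have "Max ?S \<in> ?S" by (intro Max_in) blast+
    then obtain i where "i < ?k" "l (snd (q ! i)) = Max ?S" by auto
    then show thesis by (intro that[of i]) auto
  qed
  \<comment> \<open>Vertices are indexed by the edge that enters them; \<open>pre\<close> and
    \<open>post\<close> are the cyclic neighbours of \<open>i\<close>, and differ because the length
    is at least 3.\<close>
  define pre where "pre = (if i = 0 then ?k - 1 else i - 1)"
  define post where "post = (if Suc i = ?k then 0 else Suc i)"
  have bounds: "pre < ?k" "post < ?k" "pre \<noteq> post"
    using i \<open>\<not> ?k < 3\<close> by (auto simp: pre_def post_def)
  have fst_i: "fst (q ! i) = snd (q ! pre)"
    using consecutive[of "i - 1"] closed i by (auto simp: pre_def)
  have fst_post: "fst (q ! post) = snd (q ! i)"
  proof (cases "Suc i = ?k")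
    case True
    then have "?k - 1 = i" by linarith
    then show ?thesis using closed True by (simp add: post_def)
  qed (use consecutive[of i] i in \<open>auto simp: post_def\<close>)
  have "(snd (q ! pre), snd (q ! i)) \<in> A \<or> (snd (q ! i), snd (q ! pre)) \<in> A"
    using arcs nth_mem[OF i] fst_i by (metis prod.collapse)
  then have "(snd (q ! pre), snd (q ! i)) \<in> A"
    using level max[OF bounds(1)] by fastforce
  moreover have "(snd (q ! i), snd (q ! post)) \<in> A \<or> (snd (q ! post), snd (q ! i)) \<in> A"
    using arcs nth_mem[OF bounds(2)] fst_post by (metis prod.collapse)
  then have "(snd (q ! post), snd (q ! i)) \<in> A"
    using level max[OF bounds(2)] by fastforce
  ultimately show False using parent nth_eq bounds by blast
qed

section \<open>Translation between library walks, \<open>s_arc\<close> and relation powers\<close>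

lemma pcas_nth:
  assumes "pcas u q w" "q \<noteq> []"
  shows "fst (q ! 0) = u \<and> snd (q ! (length q - 1)) = w \<and>
    (\<forall>i. Suc i < length q \<longrightarrow> snd (q ! i) = fst (q ! Suc i))"
  using assms
proof (induction q arbitrary: u)
  case (Cons e q)
  show ?case
  proof (cases "q = []")
    case False
    then show ?thesis
      using Cons.IH[of "snd e"] Cons.prems by (auto simp: nth_Cons split: nat.split)
  qed (use Cons.prems in auto)
qed simp

lemma pcas_pawalk_verts: "pcas u q w \<Longrightarrow> pawalk_verts u q = u # map snd q"
  by (induction q arbitrary: u) auto

lemma relpow_imp_s_arc:
  assumes "pair_wf_digraph D" "acyclic (parcs D)" "u \<in> pverts D" "(u, v) \<in> parcs D ^^ s"
  shows "\<exists>us. s_arc D s u us v"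
proof -
  interpret pair_wf_digraph D by (rule assms(1))
  obtain f where f: "f 0 = u" "f s = v" "\<And>i. i < s \<Longrightarrow> (f i, f (Suc i)) \<in> parcs D"
    using assms(4) by (auto simp: relpow_fun_conv)
  have verts: "f i \<in> pverts D" if "i \<le> s" for i
  proof (cases i)
    case (Suc j)
    then show ?thesis using f(3)[of j] that arc_snd_in_verts by fastforce
  qed (use f(1) assms(3) in simp)
  \<comment> \<open>Backtracking would produce a directed cycle of length 2.\<close>
  have nonbacktracking: "f (i - 1) \<noteq> f (i + 1)" if "0 < i" "i < s" for i
  proof
    assume "f (i - 1) = f (i + 1)"
    then have "(f i, f i) \<in> (parcs D)\<^sup>+"
      using f(3)[of "i - 1"] f(3)[of i] that by (auto intro: trancl_into_trancl)
    then show False using assms(2) by (auto simp: acyclic_def)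
  qed
  have "s_arc D s u (map f [0..<Suc s]) v"
    unfolding s_arc_def using f verts nonbacktracking
    by (auto simp: nth_append simp del: upt_Suc)
  then show ?thesis by blast
qed

text \<open>Membership of \<open>u\<close> has content for \<open>s = 0\<close>, where the relation
  power is the identity on the whole type.\<close>

lemma s_arc_iff_relpow:
  assumes "pair_wf_digraph D" "acyclic (parcs D)"
  shows "(\<exists>us. s_arc D s u us v) \<longleftrightarrow> u \<in> pverts D \<and> (u, v) \<in> parcs D ^^ s"
proof
  assume "\<exists>us. s_arc D s u us v"
  then obtain us where us: "s_arc D s u us v" by blast
  then have "us ! 0 \<in> set us" by (intro nth_mem) (simp add: s_arc_def)
  then have "u \<in> pverts D" using us by (auto simp: s_arc_def)
  moreover have "(u, v) \<in> parcs D ^^ s"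
    using us unfolding relpow_fun_conv s_arc_def by (intro exI[of _ "(!) us"]) auto
  ultimately show "u \<in> pverts D \<and> (u, v) \<in> parcs D ^^ s" ..
qed (use relpow_imp_s_arc[OF assms] in blast)

lemma acyclic_parcs:
  assumes "pair_wf_digraph D" "\<not> (\<exists>c. wf_digraph.closed_w D c)"
  shows "acyclic (parcs D)"
proof (rule acyclicI, intro allI notI)
  interpret pair_wf_digraph D by (rule assms(1))
  fix x assume "(x, x) \<in> (parcs D)\<^sup>+"
  then obtain c where "awalk x c x" "c \<noteq> []" using reachable1_awalk[of x x] by auto
  then have "closed_w c" by (auto simp: closed_w_def)
  then show False using assms(2) by blast
qed

text \<open>Connectedness comes from joining any two descendants through the root \<open>a\<close>;
  cycles are excluded by taking the walk length from \<open>a\<close> as level function.\<close>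

lemma underlying_tree_descendants:
  assumes wf: "pair_wf_digraph D" and ac: "acyclic (parcs D)" and a: "a \<in> pverts D"
    and layered: "\<And>x m n. (a, x) \<in> parcs D ^^ m \<Longrightarrow> (a, x) \<in> parcs D ^^ n \<Longrightarrow> m = n"
    and parent: "\<And>x x' y m n. (a, x) \<in> parcs D ^^ m \<Longrightarrow> (a, x') \<in> parcs D ^^ n \<Longrightarrow>
      (x, y) \<in> parcs D \<Longrightarrow> (x', y) \<in> parcs D \<Longrightarrow> x = x'"
  shows "underlying_tree (D \<restriction> desc D a)"
proof -
  interpret pair_wf_digraph D by (rule wf)
  define W where "W = desc D a"
  define H where "H = with_proj D \<restriction> W"
  have W_iff: "x \<in> W \<longleftrightarrow> (\<exists>n. (a, x) \<in> parcs D ^^ n)" for x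
    unfolding W_def desc_def using s_arc_iff_relpow[OF wf ac] a by simp
  have H_simps: "verts H = W" "arcs H = {(x, y) \<in> parcs D. x \<in> W \<and> y \<in> W}"
      "tail H = fst" "head H = snd"
    by (auto simp: H_def induce_subgraph_def)
  interpret H: wf_digraph H
    by unfold_locales (auto simp: H_simps)
  let ?M = "mk_symmetric H"
  interpret M: pair_wf_digraph ?M by (rule H.wellformed_mk_symmetric)
  have M_verts: "pverts ?M = W" by (simp add: H_simps)
  have M_arcs: "(x, y) \<in> parcs ?M \<longleftrightarrow> (x, y) \<in> arcs H \<or> (y, x) \<in> arcs H" for x y
    by (auto simp: parcs_mk_symmetric H_simps)
  have aW: "a \<in> W" unfolding W_iff by (rule exI[of _ 0]) simp
  have from_a: "a \<rightarrow>\<^sup>*\<^bsub>?M\<^esub> x" if "(a, x) \<in> parcs D ^^ n" for n x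
    using that
  proof (induction n arbitrary: x)
    case 0
    then show ?case using aW M_verts by simp
  next
    case (Suc n)
    then obtain y where y: "(a, y) \<in> parcs D ^^ n" "(y, x) \<in> parcs D" by auto
    moreover have "x \<in> W" "y \<in> W" using Suc.prems y unfolding W_iff by blast+
    ultimately have "(y, x) \<in> parcs ?M" by (simp add: M_arcs H_simps)
    with Suc.IH[OF y(1)] show ?case by (intro M.reachable_adj_trans[of a y x]) simp_all
  qed
  have "x \<rightarrow>\<^sup>*\<^bsub>?M\<^esub> y" if "x \<in> W" "y \<in> W" for x y
  proof -
    have "a \<rightarrow>\<^sup>*\<^bsub>?M\<^esub> x" "a \<rightarrow>\<^sup>*\<^bsub>?M\<^esub> y" using that from_a W_iff by auto
    moreover have "x \<rightarrow>\<^sup>*\<^bsub>?M\<^esub> a"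
      by (rule symmetric_reachable[OF symmetric_mk_symmetric]) (rule \<open>a \<rightarrow>\<^sup>*\<^bsub>?M\<^esub> x\<close>)
    ultimately show ?thesis using M.reachable_trans by blast
  qed
  then have "connected H"
    using aW M_verts unfolding connected_def strongly_connected_def by auto
  moreover have False if q: "pre_digraph.cycle ?M q" "length q \<ge> 3" for q
  proof -
    obtain u where u: "pcas u q u" "set q \<subseteq> parcs ?M" "distinct (tl (pawalk_verts u q))" "q \<noteq> []"
      using q(1) unfolding M.cycle_def M.awalk_def by auto
    define l where "l x = (THE n. (a, x) \<in> parcs D ^^ n)" for x
    have l: "l x = n" if "(a, x) \<in> parcs D ^^ n" for x n
      unfolding l_def using that layered by blast
    have "length q < 3"
    proof (rule no_cycle_of_unique_parent[of "arcs H" l])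
      show "l y = Suc (l x)" if xy: "(x, y) \<in> arcs H" for x y
      proof -
        obtain n where "(a, x) \<in> parcs D ^^ n" "(x, y) \<in> parcs D"
          using xy by (auto simp: H_simps W_iff)
        then show ?thesis using l[of x n] l[of y "Suc n"] by auto
      qed
      show "x = x'" if "(x, y) \<in> arcs H" "(x', y) \<in> arcs H" for x x' y
        using that parent by (auto simp: H_simps W_iff)
      show "(x, y) \<in> arcs H \<or> (y, x) \<in> arcs H" if "(x, y) \<in> set q" for x y
        using that u(2) M_arcs by blast
      \<comment> \<open>The vertex list of a closed walk names its start twice; dropping the first
        entry leaves the heads of the edges.\<close>
      show "distinct (map snd q)" using u(3) pcas_pawalk_verts[OF u(1)] by simp
    qed (use pcas_nth[OF u(1,4)] in auto)
    then show False using q(2) by simp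
  qed
  ultimately show ?thesis
    unfolding underlying_tree_def H_def W_def by blast
qed

section \<open>The theorem, by instantiating the locale\<close>

theorem theorem1p1:
  fixes D :: "'a pair_pre_digraph" and p :: nat
  assumes "pair_loopfree_digraph D"
    and "infinite (pverts D)"
    and "connected D"
    and "primitive_digraph D"
    and "distance_transitive D"
    and "\<forall>v\<in>pverts D. finite (out_arcs D v)"
    and "\<not> (\<exists>c. wf_digraph.closed_w D c)"
    and "prime p"
    and "\<forall>v\<in>pverts D. out_degree D v = p ^ 2"
  shows "\<forall>\<alpha>\<in>pverts D. underlying_tree (D \<restriction> desc D \<alpha>)"
proof
  interpret pair_loopfree_digraph D by (rule assms(1))
  have wf: "pair_wf_digraph D" by unfold_locales
  have ac: "acyclic (parcs D)" by (rule acyclic_parcs[OF wf assms(7)])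
  interpret S: square_valency_digraph "pverts D" "parcs D" "Aut D" p
  proof
    show "parcs D \<subseteq> pverts D \<times> pverts D"
      using arc_fst_in_verts arc_snd_in_verts by force
    show "bij_betw g (pverts D) (pverts D)" if "g \<in> Aut D" for g
      using that permutes_imp_bij by (auto simp: Aut_def)
    show "(g u, g v) \<in> parcs D \<longleftrightarrow> (u, v) \<in> parcs D"
      if "g \<in> Aut D" "u \<in> pverts D" "v \<in> pverts D" for g u v
      using that by (auto simp: Aut_def)
    show "\<exists>g\<in>Aut D. g u = v" if "u \<in> pverts D" "v \<in> pverts D" for u v
      using that assms(4)
      by (auto simp: primitive_digraph_def acts_primitively_def acts_transitively_def)
    show "\<exists>g\<in>Aut D. g u = u' \<and> g v = v'"
      if "u \<in> pverts D" "u' \<in> pverts D" "(u, v) \<in> parcs D ^^ n" "(u', v') \<in> parcs D ^^ n"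
        "\<forall>t<n. (u, v) \<notin> parcs D ^^ t" "\<forall>t<n. (u', v') \<notin> parcs D ^^ t" for u u' v v' n
    proof -
      have "(u, v) \<in> pairs_at_distance D n" "(u', v') \<in> pairs_at_distance D n"
        using that unfolding pairs_at_distance_def s_arc_iff_relpow[OF wf ac] by auto
      then show ?thesis
        using assms(5) unfolding distance_transitive_def acts_transitively_def by fastforce
    qed
    show "R = Id_on (pverts D) \<or> R = pverts D \<times> pverts D"
      if "equiv (pverts D) R" "\<And>g x y. g \<in> Aut D \<Longrightarrow> (x, y) \<in> R \<Longrightarrow> (g x, g y) \<in> R" for R
      using that assms(4) unfolding primitive_digraph_def acts_primitively_def by blast
    show "card (parcs D `` {u}) = p ^ 2" if "u \<in> pverts D" for u
    proof -
      \<comment> \<open>Arcs are pairs, so counting out-arcs amounts to counting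
        out-neighbours.\<close>
      have "out_arcs (with_proj D) u = Pair u ` (parcs D `` {u})"
        by (auto simp: out_arcs_def)
      then have "card (out_arcs (with_proj D) u) = card (parcs D `` {u})"
        by (simp add: card_image inj_on_def)
      then show ?thesis using assms(9) that by (simp add: out_degree_def)
    qed
  qed (use ac assms(8) in auto)
  fix \<alpha> assume "\<alpha> \<in> pverts D"
  from underlying_tree_descendants[OF wf ac this S.relpow_unique[OF this] S.unique_parent[OF this]]
  show "underlying_tree (D \<restriction> desc D \<alpha>)" .
qed

end
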